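(* Every topologically virtually nilpotent, compactly generated, locally compact Hausdorff group has finite asymptotic dimension.
   Context: A subgroup $P$ of a topological group $G$ is cocompact if there is a compact subset $K\subseteq G$ with $G=KP$. $G$ is topologically virtually nilpotent (TVN) if it has a nilpotent cocompact subgroup. The asymptotic dimension $\mathrm{asdim}(G)$ of a second countable locally compact group is its (Gromov) asymptotic dimension with respect to any plig metric, i.e. a proper left-invariant metric generating the topology (any two are coarsely equivalent); for general locally compact $G$, $\mathrm{asdim}(G)$ is the supremum of $\mathrm{asdim}(K)$ over compactly generated closed subgroups $K\le G$, equivalently the asymptotic dimension of $G$ with its canonical left coarse structure, whose controlled sets are the $E\subseteq G\times G$ with $\{x^{-1}y:(x,y)\in E\}$ relatively compact. *)

theory Defs
  imports "HOL-Analysis.Analysis" "HOL-Algebra.Generated_Groups" "HOL-Library.Extended_Nat"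
begin

locale topological_group = group G for G :: "('a, 'b) monoid_scheme" (structure) +
  fixes T :: "'a topology"
  assumes topspace_eq_carrier: "topspace T = carrier G"
    and continuous_mult: "continuous_map (prod_topology T T) T (\<lambda>(x, y). x \<otimes> y)"
    and continuous_inv: "continuous_map T T (\<lambda>x. inv x)"

definition compactly_generated_group :: "('a, 'b) monoid_scheme \<Rightarrow> 'a topology \<Rightarrow> bool" where
  "compactly_generated_group G T \<longleftrightarrow> (\<exists>C. compactin T C \<and> generate G C = carrier G)"

primrec lower_central :: "('a, 'b) monoid_scheme \<Rightarrow> nat \<Rightarrow> 'a set" where
  "lower_central G 0 = carrier G"
| "lower_central G (Suc n) =
     generate G (\<Union>x \<in> lower_central G n. \<Union>y \<in> carrier G.
       {x \<otimes>\<^bsub>G\<^esub> y \<otimes>\<^bsub>G\<^esub> inv\<^bsub>G\<^esub> x \<otimes>\<^bsub>G\<^esub> inv\<^bsub>G\<^esub> y})"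

definition nilpotent_group :: "('a, 'b) monoid_scheme \<Rightarrow> bool" where
  "nilpotent_group G \<longleftrightarrow> group G \<and> (\<exists>n. lower_central G n = {\<one>\<^bsub>G\<^esub>})"

definition cocompact_subgroup :: "'a set \<Rightarrow> ('a, 'b) monoid_scheme \<Rightarrow> 'a topology \<Rightarrow> bool" where
  "cocompact_subgroup P G T \<longleftrightarrow>
     subgroup P G \<and> (\<exists>K. compactin T K \<and> carrier G = K <#>\<^bsub>G\<^esub> P)"

text \<open>The nilpotent cocompact subgroup is not required to be closed.\<close>

definition topologically_virtually_nilpotent ::
    "('a, 'b) monoid_scheme \<Rightarrow> 'a topology \<Rightarrow> bool" where
  "topologically_virtually_nilpotent G T \<longleftrightarrow>
     (\<exists>P. cocompact_subgroup P G T \<and> nilpotent_group (G\<lparr>carrier := P\<rparr>))"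

text \<open>Asymptotic dimension of a set \<open>X\<close> equipped with a coarse structure, given as the
  collection \<open>\<E>\<close> of its controlled sets. When \<open>\<E>\<close> comes from a metric, this is Gromov's
  definition: for every \<open>r\<close> there is a uniformly bounded cover of \<open>X\<close> that is a union of
  \<open>n + 1\<close> families, each of them \<open>r\<close>-disjoint. The dimension is \<open>\<infinity>\<close> (the infimum of the empty
  set) if there is no such \<open>n\<close>.\<close>

definition asdim_le :: "'a set \<Rightarrow> ('a \<times> 'a) set set \<Rightarrow> nat \<Rightarrow> bool" where
  "asdim_le X \<E> n \<longleftrightarrow>
     (\<forall>E \<in> \<E>. \<exists>\<U> :: nat \<Rightarrow> 'a set set.
        (\<Union>i\<le>n. \<Union>(\<U> i)) = X \<and>
        (\<forall>i\<le>n. \<forall>A \<in> \<U> i. \<forall>B \<in> \<U> i. A \<noteq> B \<longrightarrow> (A \<times> B) \<inter> E = {}) \<and>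
        (\<Union>i\<le>n. \<Union>A \<in> \<U> i. A \<times> A) \<in> \<E>)"

definition coarse_asdim :: "'a set \<Rightarrow> ('a \<times> 'a) set set \<Rightarrow> enat" where
  "coarse_asdim X \<E> = Inf {enat n | n. asdim_le X \<E> n}"

definition left_coarse_structure ::
    "('a, 'b) monoid_scheme \<Rightarrow> 'a topology \<Rightarrow> ('a \<times> 'a) set set" where
  "left_coarse_structure G T =
     {E. E \<subseteq> carrier G \<times> carrier G \<and>
         compactin T (T closure_of ((\<lambda>(x, y). inv\<^bsub>G\<^esub> x \<otimes>\<^bsub>G\<^esub> y) ` E))}"

text \<open>A compactly generated locally compact group need not be second countable, hence need
  not carry a proper left-invariant compatible metric, so the asymptotic dimension is taken with
  respect to the canonical left coarse structure.\<close>

definition asdim :: "('a, 'b) monoid_scheme \<Rightarrow> 'a topology \<Rightarrow> enat" where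
  "asdim G T = coarse_asdim (carrier G) (left_coarse_structure G T)"

end

theory Submission
  imports Defs
begin

text \<open>Let \<open>P\<close> be a nilpotent cocompact subgroup. Choosing a compact symmetric generating neighbourhood
  \<open>U\<close> of the identity that is large enough, compactness of \<open>U\<^sup>2\<close> gives a finite \<open>F \<subseteq> P\<close> with
  \<open>U\<^sup>2 \<subseteq> F U\<close>, hence \<open>U\<^sup>n \<subseteq> F\<^sup>n U\<close> for all \<open>n\<close>. As \<open>P\<close> is nilpotent, \<open>\<bar>F\<^sup>n\<bar>\<close> is bounded by a
  polynomial in \<open>n\<close>, and so is the largest size \<open>p(n)\<close> of a \<open>U\<^sup>2\<close>-separated subset of \<open>U\<^sup>n\<close>.
  Polynomial growth forces \<open>p(16k) \<le> D p(k)\<close> with \<open>D\<close> fixed for arbitrarily large \<open>k\<close>. At such a scale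
  let \<open>X\<close> be a maximal \<open>U\<^bsup>4k\<^esup>\<close>-separated set: by homogeneity each point of \<open>X\<close> has at most \<open>D\<close>
  neighbours in \<open>X\<close> within \<open>U\<^bsup>12k\<^esup>\<close>, so \<open>D + 1\<close> colours separate them, and the translates \<open>x U\<^bsup>4k\<^esup>\<close>,
  sorted by the colour of \<open>x \<in> X\<close>, form the required cover.\<close>

section \<open>Products of words and word balls\<close>

definition list_prod :: "('a, 'b) monoid_scheme \<Rightarrow> 'a list \<Rightarrow> 'a" where
  "list_prod G xs = foldr (\<otimes>\<^bsub>G\<^esub>) xs \<one>\<^bsub>G\<^esub>"

text \<open>Only letters of \<open>A\<close> itself occur, never their inverses; where inverses
  matter, \<open>A\<close> is assumed symmetric. Words of length at most \<open>n\<close>, rather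
  than exactly \<open>n\<close>, make the balls nested whether or not \<open>A\<close> contains the
  identity.\<close>

definition word_ball :: "('a, 'b) monoid_scheme \<Rightarrow> 'a set \<Rightarrow> nat \<Rightarrow> 'a set" where
  "word_ball G A n = {list_prod G xs | xs. set xs \<subseteq> A \<and> length xs \<le> n}"

lemma list_prod_simps [simp]:
  "list_prod G [] = \<one>\<^bsub>G\<^esub>"
  "list_prod G (x # xs) = x \<otimes>\<^bsub>G\<^esub> list_prod G xs"
  by (simp_all add: list_prod_def)

text \<open>Restricting the carrier changes neither multiplication nor unit. This is how a growth
  bound proved inside the subgroup \<open>P\<close> is later read in \<open>G\<close>.\<close>

lemma list_prod_carrier_update [simp]: "list_prod (G\<lparr>carrier := P\<rparr>) xs = list_prod G xs"
  by (simp add: list_prod_def)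

lemma word_ball_carrier_update [simp]: "word_ball (G\<lparr>carrier := P\<rparr>) A n = word_ball G A n"
  by (simp add: word_ball_def)

lemma word_ball_memI: "set xs \<subseteq> A \<Longrightarrow> length xs \<le> n \<Longrightarrow> list_prod G xs \<in> word_ball G A n"
  unfolding word_ball_def by blast

lemma word_ball_memE:
  assumes "x \<in> word_ball G A n"
  obtains xs where "set xs \<subseteq> A" "length xs \<le> n" "x = list_prod G xs"
  using assms unfolding word_ball_def by blast

lemma word_ball_mono: "m \<le> n \<Longrightarrow> A \<subseteq> B \<Longrightarrow> word_ball G A m \<subseteq> word_ball G B n"
  unfolding word_ball_def by force

lemma one_in_word_ball [simp]: "\<one>\<^bsub>G\<^esub> \<in> word_ball G A n"
  using word_ball_memI[of "[]" A n G] by simp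

lemma finite_word_ball: "finite A \<Longrightarrow> finite (word_ball G A n)"
  unfolding word_ball_def
  by (rule finite_subset[OF _ finite_imageI[OF finite_lists_length_le[of A n], of "list_prod G"]]) auto

context group
begin

lemma list_prod_closed [simp]: "set xs \<subseteq> carrier G \<Longrightarrow> list_prod G xs \<in> carrier G"
  by (induction xs) auto

lemma list_prod_append:
  "set xs \<subseteq> carrier G \<Longrightarrow> set ys \<subseteq> carrier G \<Longrightarrow>
    list_prod G (xs @ ys) = list_prod G xs \<otimes> list_prod G ys"
  by (induction xs) (auto simp: m_assoc)

lemma word_ball_subset_carrier: "A \<subseteq> carrier G \<Longrightarrow> word_ball G A n \<subseteq> carrier G"
  unfolding word_ball_def by auto

lemma word_ball_mult:
  assumes "A \<subseteq> carrier G" "x \<in> word_ball G A m" "y \<in> word_ball G A n"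
  shows "x \<otimes> y \<in> word_ball G A (m + n)"
proof -
  obtain xs where xs: "set xs \<subseteq> A" "length xs \<le> m" "x = list_prod G xs"
    using assms(2) by (rule word_ball_memE)
  obtain ys where ys: "set ys \<subseteq> A" "length ys \<le> n" "y = list_prod G ys"
    using assms(3) by (rule word_ball_memE)
  have "x \<otimes> y = list_prod G (xs @ ys)"
    using xs ys assms(1) by (subst list_prod_append) auto
  then show ?thesis
    using xs ys word_ball_memI[of "xs @ ys" A "m + n" G] by auto
qed

lemma subset_word_ball: "A \<subseteq> carrier G \<Longrightarrow> 1 \<le> n \<Longrightarrow> A \<subseteq> word_ball G A n"
proof
  fix x assume "A \<subseteq> carrier G" "1 \<le> n" "x \<in> A"
  then show "x \<in> word_ball G A n"
    using word_ball_memI[of "[x]" A n G] by auto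
qed

lemma word_ball_inv:
  assumes "A \<subseteq> carrier G" "\<And>a. a \<in> A \<Longrightarrow> inv a \<in> A" "x \<in> word_ball G A n"
  shows "inv x \<in> word_ball G A n"
proof -
  obtain xs where xs: "set xs \<subseteq> A" "length xs \<le> n" "x = list_prod G xs"
    using assms(3) by (rule word_ball_memE)
  have "inv (list_prod G ys) \<in> word_ball G A (length ys)" if "set ys \<subseteq> A" for ys
    using that
  proof (induction ys)
    case (Cons y ys)
    then have c: "y \<in> carrier G" "list_prod G ys \<in> carrier G" "inv y \<in> A"
      using assms by auto
    have "inv (list_prod G ys) \<otimes> inv y \<in> word_ball G A (length ys + 1)"
      using Cons c subset_word_ball[OF assms(1), of 1] by (intro word_ball_mult[OF assms(1)]) auto
    then show ?case
      using c by (simp add: inv_mult_group)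
  qed simp
  with xs show ?thesis
    using word_ball_mono[of "length xs" n A A G] by blast
qed

lemma generate_subset_word_balls:
  assumes "A \<subseteq> carrier G" "\<And>a. a \<in> A \<Longrightarrow> inv a \<in> A"
  shows "generate G A \<subseteq> (\<Union>n. word_ball G A n)"
proof
  fix x assume "x \<in> generate G A"
  then show "x \<in> (\<Union>n. word_ball G A n)"
  proof induction
    case one
    then show ?case by simp
  next
    case (incl h)
    then show ?case using subset_word_ball[OF assms(1), of 1] by blast
  next
    case (inv h)
    then show ?case using subset_word_ball[OF assms(1), of 1] assms(2) by blast
  next
    case (eng h1 h2)
    then show ?case using word_ball_mult[OF assms(1)] by blast
  qed
qed

subsection \<open>Polynomial growth of finitely generated nilpotent groups\<close>

text \<open>This form of the commutator puts the correction term on the right,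
  \<open>a b = b a [a,b]\<close>. So when \<open>f\<close> moves left past \<open>a\<close>, the new
  letter appears just behind \<open>a\<close> and \<open>f\<close> never has to cross it.\<close>

definition backcomm :: "'a \<Rightarrow> 'a \<Rightarrow> 'a" where
  "backcomm a b = inv a \<otimes> inv b \<otimes> a \<otimes> b"

lemma backcomm_closed [simp]: "a \<in> carrier G \<Longrightarrow> b \<in> carrier G \<Longrightarrow> backcomm a b \<in> carrier G"
  by (simp add: backcomm_def)

lemma swap_backcomm:
  assumes "a \<in> carrier G" "b \<in> carrier G"
  shows "a \<otimes> b = b \<otimes> a \<otimes> backcomm a b"
proof -
  have "b \<otimes> a \<otimes> backcomm a b = b \<otimes> (a \<otimes> (inv a \<otimes> (inv b \<otimes> (a \<otimes> b))))"
    using assms by (simp add: backcomm_def m_assoc)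
  also have "\<dots> = a \<otimes> b"
    using assms by (simp add: m_assoc[symmetric])
  finally show ?thesis by simp
qed

text \<open>Commutators created by moving \<open>f\<close> have higher level, so with a letter of level \<open>i\<close> weighing
  \<open>t\<^sup>i\<close> each move multiplies the weight of the word by at most \<open>1 + t\<close>. Taking \<open>t = 1/n\<close>, up to \<open>n\<close>
  moves cost only a bounded factor.\<close>

lemma move_letter_left:
  fixes lev :: "'a \<Rightarrow> nat" and t :: real
  assumes "A \<subseteq> carrier G" "f \<in> A" "0 \<le> t" "t \<le> 1"
    and comm: "\<And>a. a \<in> A - {f} \<Longrightarrow>
      backcomm a f = \<one> \<or> backcomm a f \<in> A - {f} \<and> lev a < lev (backcomm a f)"
    and "set ys \<subseteq> A - {f}"
  shows "\<exists>zs. set zs \<subseteq> A - {f} \<and> list_prod G ys \<otimes> f = f \<otimes> list_prod G zs \<and>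
    (\<Sum>z\<leftarrow>zs. t ^ lev z) \<le> (1 + t) * (\<Sum>y\<leftarrow>ys. t ^ lev y)"
  using assms(6)
proof (induction ys)
  case Nil
  then show ?case using assms by (intro exI[of _ "[]"]) auto
next
  case (Cons a ys)
  then obtain zs where zs: "set zs \<subseteq> A - {f}" "list_prod G ys \<otimes> f = f \<otimes> list_prod G zs"
    "(\<Sum>z\<leftarrow>zs. t ^ lev z) \<le> (1 + t) * (\<Sum>y\<leftarrow>ys. t ^ lev y)"
    by auto
  have a: "a \<in> A - {f}" "a \<in> carrier G" "f \<in> carrier G" "set ys \<subseteq> carrier G" "set zs \<subseteq> carrier G"
    using Cons.prems assms zs by auto
  \<comment> \<open>By induction \<open>f\<close> has already crossed the tail, so it now swaps with
    \<open>a\<close> alone and creates a single commutator.\<close>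
  have "list_prod G (a # ys) \<otimes> f = a \<otimes> f \<otimes> list_prod G zs"
    using a zs(2) by (simp add: m_assoc)
  also have "\<dots> = f \<otimes> (a \<otimes> (backcomm a f \<otimes> list_prod G zs))"
    using a by (subst swap_backcomm) (simp_all add: m_assoc)
  finally have eq: "list_prod G (a # ys) \<otimes> f = f \<otimes> (a \<otimes> (backcomm a f \<otimes> list_prod G zs))" .
  show ?case
    using comm[OF a(1)]
  proof
    assume "backcomm a f = \<one>"
    then have "list_prod G (a # ys) \<otimes> f = f \<otimes> list_prod G (a # zs)"
      using eq a by simp
    moreover have "0 \<le> t * t ^ lev a" using assms by simp
    ultimately show ?thesis
      using zs a by (intro exI[of _ "a # zs"]) (auto simp: algebra_simps)
  next
    assume c: "backcomm a f \<in> A - {f} \<and> lev a < lev (backcomm a f)"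
    then have "t ^ lev (backcomm a f) \<le> t ^ Suc (lev a)"
      using assms by (intro power_decreasing) auto
    then show ?thesis
      using zs a c eq by (intro exI[of _ "a # backcomm a f # zs"]) (auto simp: algebra_simps)
  qed
qed

text \<open>The word is read from left to right: each \<open>f\<close> is carried to the front
  across the letters kept so far, including earlier commutators, and any other letter is appended.
  One step multiplies the weight by at most \<open>1 + t\<close> or adds at most \<open>1\<close>,
  and \<open>m * (1 + t) ^ m\<close> dominates \<open>m\<close> such steps.\<close>

lemma collect_letter:
  fixes lev :: "'a \<Rightarrow> nat" and t :: real
  assumes "A \<subseteq> carrier G" "f \<in> A" "0 \<le> t" "t \<le> 1"
    and comm: "\<And>a. a \<in> A - {f} \<Longrightarrow>
      backcomm a f = \<one> \<or> backcomm a f \<in> A - {f} \<and> lev a < lev (backcomm a f)"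
    and "set xs \<subseteq> A"
  shows "\<exists>e ys. e \<le> length xs \<and> set ys \<subseteq> A - {f} \<and>
    list_prod G xs = f [^] (e::nat) \<otimes> list_prod G ys \<and>
    (\<Sum>y\<leftarrow>ys. t ^ lev y) \<le> length xs * (1 + t) ^ length xs"
  using assms(6)
proof (induction xs rule: rev_induct)
  case Nil
  then show ?case using assms by (intro exI[of _ 0] exI[of _ "[]"]) auto
next
  case (snoc x xs)
  then obtain e ys where ys: "e \<le> length xs" "set ys \<subseteq> A - {f}"
    "list_prod G xs = f [^] (e::nat) \<otimes> list_prod G ys"
    "(\<Sum>y\<leftarrow>ys. t ^ lev y) \<le> length xs * (1 + t) ^ length xs"
    by auto
  have c: "x \<in> carrier G" "f \<in> carrier G" "set xs \<subseteq> carrier G" "set ys \<subseteq> carrier G"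
    using snoc.prems assms ys by auto
  have eq: "list_prod G (xs @ [x]) = f [^] e \<otimes> (list_prod G ys \<otimes> x)"
    using c ys(3) by (simp add: list_prod_append m_assoc)
  have pow1: "1 \<le> (1 + t) ^ Suc (length xs)"
    using assms by (intro one_le_power) auto
  have bound: "(1 + t) * (\<Sum>y\<leftarrow>ys. t ^ lev y) \<le> length xs * (1 + t) ^ Suc (length xs)"
    using mult_left_mono[OF ys(4), of "1 + t"] assms by (simp add: algebra_simps)
  show ?case
  proof (cases "x = f")
    case True
    obtain zs where zs: "set zs \<subseteq> A - {f}" "list_prod G ys \<otimes> f = f \<otimes> list_prod G zs"
      "(\<Sum>z\<leftarrow>zs. t ^ lev z) \<le> (1 + t) * (\<Sum>y\<leftarrow>ys. t ^ lev y)"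
      using move_letter_left[OF assms(1-5) ys(2)] by blast
    have zc: "set zs \<subseteq> carrier G" using zs assms by auto
    have "list_prod G (xs @ [x]) = f [^] Suc e \<otimes> list_prod G zs"
      using eq True zs(2) c zc by (simp add: m_assoc)
    moreover have "(\<Sum>z\<leftarrow>zs. t ^ lev z) \<le> length (xs @ [x]) * (1 + t) ^ length (xs @ [x])"
      using zs(3) bound pow1 by (simp add: algebra_simps)
    ultimately show ?thesis
      using zs ys by (intro exI[of _ "Suc e"] exI[of _ zs]) auto
  next
    case False
    have "list_prod G (xs @ [x]) = f [^] e \<otimes> list_prod G (ys @ [x])"
      using eq c by (simp add: list_prod_append)
    moreover have "(\<Sum>z\<leftarrow>ys @ [x]. t ^ lev z) \<le> length (xs @ [x]) * (1 + t) ^ length (xs @ [x])"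
    proof -
      have "0 \<le> (\<Sum>y\<leftarrow>ys. t ^ lev y)"
        using assms by (intro sum_list_nonneg) auto
      then have "(\<Sum>y\<leftarrow>ys. t ^ lev y) \<le> (1 + t) * (\<Sum>y\<leftarrow>ys. t ^ lev y)"
        using assms by (simp add: algebra_simps)
      moreover have "t ^ lev x \<le> 1"
        using assms by (intro power_le_one) auto
      ultimately show ?thesis
        using bound pow1 by (simp add: algebra_simps)
    qed
    ultimately show ?thesis
      using ys snoc.prems False by (intro exI[of _ e] exI[of _ "ys @ [x]"]) auto
  qed
qed

text \<open>For \<open>t = 1/n\<close> the collected word has weight at most
  \<open>n * (1 + 1/n) ^ n\<close>, hence at most \<open>3 * n\<close>. Each remaining letter has
  level at most \<open>s\<close> and so weighs at least \<open>1 / n ^ s\<close>; dividing gives the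
  length bound \<open>3 * n ^ Suc s\<close>.\<close>

lemma word_ball_collect:
  fixes lev :: "'a \<Rightarrow> nat"
  assumes "A \<subseteq> carrier G" "f \<in> A" "\<And>a. a \<in> A \<Longrightarrow> lev a \<le> s" "1 \<le> n"
    and comm: "\<And>a. a \<in> A - {f} \<Longrightarrow>
      backcomm a f = \<one> \<or> backcomm a f \<in> A - {f} \<and> lev a < lev (backcomm a f)"
  shows "word_ball G A n \<subseteq>
    (\<lambda>(e, y). f [^] e \<otimes> y) ` ({0..n} \<times> word_ball G (A - {f}) (3 * n ^ Suc s))"
proof
  fix x assume "x \<in> word_ball G A n"
  then obtain xs where xs: "set xs \<subseteq> A" "length xs \<le> n" "x = list_prod G xs"
    by (rule word_ball_memE)
  define t where "t = 1 / real n"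
  have t: "0 < t" "t \<le> 1" using assms by (auto simp: t_def)
  obtain e ys where ys: "e \<le> length xs" "set ys \<subseteq> A - {f}"
    "list_prod G xs = f [^] (e::nat) \<otimes> list_prod G ys"
    "(\<Sum>y\<leftarrow>ys. t ^ lev y) \<le> length xs * (1 + t) ^ length xs"
    using collect_letter[OF assms(1,2) _ t(2) comm xs(1)] t by force
  have "length ys * t ^ s \<le> (\<Sum>y\<leftarrow>ys. t ^ lev y)"
    using ys(2)
  proof (induction ys)
    case (Cons a ys)
    then have "t ^ s \<le> t ^ lev a"
      using t assms(3)[of a] by (intro power_decreasing) auto
    then show ?case using Cons by (simp add: algebra_simps)
  qed simp
  also have "\<dots> \<le> length xs * (1 + t) ^ length xs" by (rule ys)
  also have "\<dots> \<le> n * (1 + t) ^ n"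
    using xs t by (intro mult_mono power_increasing) auto
  also have "\<dots> \<le> n * 3"
  proof -
    have "(1 + t) ^ n \<le> exp t ^ n"
      using t by (intro power_mono exp_ge_add_one_self) auto
    also have "\<dots> = exp 1"
      using assms by (simp add: t_def exp_of_nat_mult[symmetric])
    also have "\<dots> \<le> 3" by (rule exp_le)
    finally show ?thesis by (simp add: mult_left_mono)
  qed
  finally have "length ys * t ^ s \<le> n * 3" .
  then have "real (length ys) \<le> 3 * real n ^ Suc s"
    using assms by (simp add: t_def power_divide field_simps)
  then have "length ys \<le> 3 * n ^ Suc s"
    by (metis of_nat_le_iff of_nat_mult of_nat_numeral of_nat_power)
  then have "list_prod G ys \<in> word_ball G (A - {f}) (3 * n ^ Suc s)"
    using ys by (intro word_ball_memI)
  with ys xs show "x \<in> (\<lambda>(e, y). f [^] e \<otimes> y) ` ({0..n} \<times> word_ball G (A - {f}) (3 * n ^ Suc s))"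
    by force
qed

text \<open>Induction on the alphabet: a letter \<open>f\<close> of minimal level is collected and
  removed. Its exponent has \<open>n + 1\<close> possible values, and the rest is a word of
  polynomially bounded length over one letter fewer, so a degree \<open>d\<close> becomes
  \<open>1 + Suc s * d\<close>.\<close>

lemma polynomial_growth_of_graded_set:
  fixes lev :: "'a \<Rightarrow> nat"
  assumes "finite A" "A \<subseteq> carrier G" "\<And>a. a \<in> A \<Longrightarrow> lev a \<le> s"
    and "\<And>a b. a \<in> A \<Longrightarrow> b \<in> A \<Longrightarrow>
      backcomm a b = \<one> \<or> backcomm a b \<in> A \<and> max (lev a) (lev b) < lev (backcomm a b)"
  shows "\<exists>C d. \<forall>n\<ge>1. card (word_ball G A n) \<le> C * n ^ d"
  using assms
proof (induction "card A" arbitrary: A)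
  case 0
  then have "A = {}" by simp
  then have "word_ball G A n = {\<one>}" for n
    by (auto simp: word_ball_def)
  then show ?case by (intro exI[of _ 1] exI[of _ 0]) auto
next
  case (Suc k)
  then have ne: "A \<noteq> {}" by auto
  define f where "f = arg_min_on lev A"
  have f: "f \<in> A" "\<And>a. a \<in> A \<Longrightarrow> lev f \<le> lev a"
    using arg_min_if_finite[of A lev] Suc ne by (auto simp: f_def not_less)
  \<comment> \<open>A nontrivial commutator has level above that of \<open>a\<close>, hence above
    the minimum, so it differs from \<open>f\<close> and the smaller alphabet is still
    closed.\<close>
  have sub: "backcomm a b = \<one> \<or> backcomm a b \<in> A - {f} \<and> max (lev a) (lev b) < lev (backcomm a b)"
    if "a \<in> A" "b \<in> A" for a b
    using Suc.prems(4)[OF that] f(2)[OF that(1)] by auto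
  obtain C d where IH: "\<And>n. 1 \<le> n \<Longrightarrow> card (word_ball G (A - {f}) n) \<le> C * n ^ d"
  proof -
    have "\<exists>C d. \<forall>n\<ge>1. card (word_ball G (A - {f}) n) \<le> C * n ^ d"
    proof (rule Suc.hyps(1))
      show "k = card (A - {f})" using Suc f by simp
    qed (use Suc.prems sub in auto)
    then show ?thesis using that by blast
  qed
  have "card (word_ball G A n) \<le> (2 * C * 3 ^ d) * n ^ (1 + Suc s * d)" if n: "1 \<le> n" for n
  proof -
    have "word_ball G A n \<subseteq>
      (\<lambda>(e, y). f [^] e \<otimes> y) ` ({0..n} \<times> word_ball G (A - {f}) (3 * n ^ Suc s))"
    proof (rule word_ball_collect[OF Suc.prems(2) f(1) Suc.prems(3) n])
      show "backcomm a f = \<one> \<or> backcomm a f \<in> A - {f} \<and> lev a < lev (backcomm a f)"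
        if "a \<in> A - {f}" for a
        using sub[of a f] f(1) that by auto
    qed
    then have "card (word_ball G A n) \<le>
      card ((\<lambda>(e, y). f [^] e \<otimes> y) ` ({0..n} \<times> word_ball G (A - {f}) (3 * n ^ Suc s)))"
      using Suc.prems(1)
      by (intro card_mono finite_imageI finite_cartesian_product finite_word_ball) auto
    also have "\<dots> \<le> card ({0..n} \<times> word_ball G (A - {f}) (3 * n ^ Suc s))"
      using Suc.prems by (intro card_image_le finite_cartesian_product finite_word_ball) auto
    also have "\<dots> = Suc n * card (word_ball G (A - {f}) (3 * n ^ Suc s))"
      by (simp add: card_cartesian_product)
    also have "\<dots> \<le> (2 * n) * (C * (3 * n ^ Suc s) ^ d)"
      using n by (intro mult_mono IH) auto
    also have "\<dots> = (2 * C * 3 ^ d) * n ^ (1 + Suc s * d)"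
      by (simp add: power_mult_distrib power_mult[symmetric] power_add mult.commute mult.left_commute
          distrib_left)
    finally show ?thesis .
  qed
  then show ?case by blast
qed

section \<open>The lower central series and commutator-closed alphabets\<close>

lemma lower_central_subgroup: "subgroup (lower_central G n) G"
proof (induction n)
  case (Suc n)
  then have "lower_central G n \<subseteq> carrier G" by (rule subgroup.subset)
  then show ?case by (auto intro!: generate_is_subgroup)
qed (simp add: subgroup_self)

lemma commutator_in_lower_central:
  "x \<in> lower_central G n \<Longrightarrow> y \<in> carrier G \<Longrightarrow>
    x \<otimes> y \<otimes> inv x \<otimes> inv y \<in> lower_central G (Suc n)"
  by (auto intro!: generate.incl)

lemma lower_central_Suc_subset: "lower_central G (Suc n) \<subseteq> lower_central G n"
proof (induction n)
  case 0
  then show ?case using subgroup.subset[OF lower_central_subgroup[of "Suc 0"]] by simp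
next
  case (Suc n)
  then show ?case
    unfolding lower_central.simps(2)[of G "Suc n"] lower_central.simps(2)[of G n]
    by (intro mono_generate) (auto simp: lower_central.simps(2)[of G n])
qed

lemma lower_central_antimono: "m \<le> n \<Longrightarrow> lower_central G n \<subseteq> lower_central G m"
  using lower_central_Suc_subset lift_Suc_antimono_le[of "lower_central G"] by blast

text \<open>The series is generated by commutators \<open>x y x^-1 y^-1\<close> with the deep
  element on the left. If \<open>a\<close> is deep, \<open>backcomm a b\<close> is such a commutator
  of \<open>a^-1\<close> and \<open>b^-1\<close>; if \<open>b\<close> is deep, it is the inverse of
  the one of \<open>b^-1\<close> and \<open>a^-1\<close>.\<close>

lemma backcomm_in_lower_central:
  assumes "a \<in> carrier G" "b \<in> carrier G" "a \<in> lower_central G n \<or> b \<in> lower_central G n"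
  shows "backcomm a b \<in> lower_central G (Suc n)"
  using assms(3)
proof
  assume "a \<in> lower_central G n"
  then have "inv a \<in> lower_central G n"
    by (rule subgroup.m_inv_closed[OF lower_central_subgroup])
  from commutator_in_lower_central[OF this, of "inv b"] show ?thesis
    using assms by (simp add: backcomm_def)
next
  assume "b \<in> lower_central G n"
  then have "inv b \<in> lower_central G n"
    by (rule subgroup.m_inv_closed[OF lower_central_subgroup])
  from commutator_in_lower_central[OF this, of "inv a"]
  have "inv b \<otimes> inv a \<otimes> b \<otimes> a \<in> lower_central G (Suc n)"
    using assms by simp
  then have "inv (inv b \<otimes> inv a \<otimes> b \<otimes> a) \<in> lower_central G (Suc n)"
    by (rule subgroup.m_inv_closed[OF lower_central_subgroup])
  then show ?thesis
    using assms by (simp add: backcomm_def inv_mult_group m_assoc)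
qed

primrec comm_closure :: "'a set \<Rightarrow> nat \<Rightarrow> 'a set" where
  "comm_closure F 0 = F"
| "comm_closure F (Suc n) =
    comm_closure F n \<union> (\<lambda>(a, b). backcomm a b) ` (comm_closure F n \<times> comm_closure F n)"

lemma comm_closure_properties:
  assumes "finite F" "F \<subseteq> carrier G"
  shows "finite (comm_closure F n)" "comm_closure F n \<subseteq> carrier G" "F \<subseteq> comm_closure F n"
  using assms by (induction n) (auto intro!: backcomm_closed)

text \<open>A commutator not already present involves a letter that was new at the previous stage.
  By induction that letter lies in the corresponding term of the series, and the commutator lies one
  term deeper. In a nilpotent group the process therefore stops, up to the identity, after finitely
  many stages.\<close>

lemma comm_closure_Suc_subset:
  assumes "finite F" "F \<subseteq> carrier G"
  shows "comm_closure F (Suc n) \<subseteq> comm_closure F n \<union> lower_central G (Suc n)"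
proof (induction n)
  case 0
  have "backcomm a b \<in> lower_central G (Suc 0)" if "a \<in> F" "b \<in> F" for a b
    using that assms by (intro backcomm_in_lower_central) auto
  then show ?case
    by (auto simp del: lower_central.simps)
next
  case (Suc n)
  have "backcomm a b \<in> comm_closure F (Suc n) \<union> lower_central G (Suc (Suc n))"
    if ab: "a \<in> comm_closure F (Suc n)" "b \<in> comm_closure F (Suc n)" for a b
  proof (cases "a \<in> comm_closure F n \<and> b \<in> comm_closure F n")
    case True
    then have "(a, b) \<in> comm_closure F n \<times> comm_closure F n" by simp
    then have "backcomm a b \<in> (\<lambda>(a, b). backcomm a b) ` (comm_closure F n \<times> comm_closure F n)"
      by (metis (no_types, lifting) case_prod_conv image_eqI)
    then show ?thesis unfolding comm_closure.simps by (rule UnI1[OF UnI2])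
  next
    case False
    with Suc ab have "a \<in> lower_central G (Suc n) \<or> b \<in> lower_central G (Suc n)" by blast
    then have "backcomm a b \<in> lower_central G (Suc (Suc n))"
      using ab comm_closure_properties(2)[OF assms, of "Suc n"]
      by (intro backcomm_in_lower_central) auto
    then show ?thesis by blast
  qed
  then show ?case
    unfolding comm_closure.simps(2)[of F "Suc n"] by (auto simp del: lower_central.simps)
qed

lemma nilpotent_polynomial_growth:
  assumes "nilpotent_group G" "finite F" "F \<subseteq> carrier G"
  shows "\<exists>C d. \<forall>n\<ge>1. card (word_ball G F n) \<le> C * n ^ d"
proof -
  obtain s where s: "lower_central G s = {\<one>}"
    using assms(1) by (auto simp: nilpotent_group_def)
  define M where "M = comm_closure F s"
  define A where "A = M - {\<one>}"
  note M = comm_closure_properties[OF assms(2,3), of s, folded M_def]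
  have "lower_central G (Suc s) \<subseteq> {\<one>}"
    using lower_central_Suc_subset[of s] s by simp
  then have Mc: "backcomm a b \<in> insert \<one> M" if "a \<in> M" "b \<in> M" for a b
    using comm_closure_Suc_subset[OF assms(2,3), of s] that by (force simp: M_def)
  \<comment> \<open>The level is the index of the deepest term containing \<open>a\<close>. The cap
    \<open>i \<le> s\<close> keeps \<open>GREATEST\<close> meaningful even for the identity, which
    lies in every term.\<close>
  define lev where "lev a = (GREATEST i. i \<le> s \<and> a \<in> lower_central G i)" for a
  have lev_le: "lev a \<le> s \<and> a \<in> lower_central G (lev a)" if "a \<in> carrier G" for a
    unfolding lev_def
    by (rule GreatestI_nat[of "\<lambda>i. i \<le> s \<and> a \<in> lower_central G i" 0 s]) (use that in auto)
  have lev_ge: "i \<le> lev a" if "a \<noteq> \<one>" "a \<in> lower_central G i" for a i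
  proof -
    have "i \<le> s"
    proof (rule ccontr)
      assume "\<not> i \<le> s"
      then have "lower_central G i \<subseteq> {\<one>}"
        using lower_central_antimono[of s i] s by auto
      with that show False by auto
    qed
    with that show ?thesis
      unfolding lev_def by (intro Greatest_le_nat[where b = s]) auto
  qed
  have "\<exists>C d. \<forall>n\<ge>1. card (word_ball G A n) \<le> C * n ^ d"
  proof (rule polynomial_growth_of_graded_set[where lev = lev and s = s])
    show "finite A" "A \<subseteq> carrier G" using M by (auto simp: A_def)
    show "lev a \<le> s" if "a \<in> A" for a
      using lev_le that M by (auto simp: A_def)
    show "backcomm a b = \<one> \<or> backcomm a b \<in> A \<and> max (lev a) (lev b) < lev (backcomm a b)"
      if ab: "a \<in> A" "b \<in> A" for a b
    proof (cases "backcomm a b = \<one>")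
      case False
      have c: "a \<in> carrier G" "b \<in> carrier G" using ab M by (auto simp: A_def)
      have "Suc (lev a) \<le> lev (backcomm a b)" "Suc (lev b) \<le> lev (backcomm a b)"
        using c lev_le by (auto intro!: lev_ge[OF False] backcomm_in_lower_central)
      then show ?thesis using False Mc ab by (auto simp: A_def)
    qed simp
  qed
  then obtain C d where Cd: "\<forall>n\<ge>1. card (word_ball G A n) \<le> C * n ^ d" by blast
  \<comment> \<open>\<open>F\<close> may contain the identity, which was excluded from the graded
    alphabet; deleting it from a word keeps the product and does not lengthen the word.\<close>
  have "word_ball G F n \<subseteq> word_ball G A n" for n
  proof
    fix x assume "x \<in> word_ball G F n"
    then obtain xs where xs: "set xs \<subseteq> F" "length xs \<le> n" "x = list_prod G xs"
      by (rule word_ball_memE)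
    have "list_prod G (filter (\<lambda>x. x \<noteq> \<one>) ys) = list_prod G ys" if "set ys \<subseteq> carrier G" for ys
      using that by (induction ys) auto
    then have "x = list_prod G (filter (\<lambda>x. x \<noteq> \<one>) xs)" using xs assms by force
    moreover have "set (filter (\<lambda>x. x \<noteq> \<one>) xs) \<subseteq> A" using xs M by (auto simp: A_def)
    ultimately show "x \<in> word_ball G A n"
      using xs by (auto intro!: word_ball_memI intro: order.trans[OF length_filter_le])
  qed
  moreover have "finite (word_ball G A n)" for n
    using M by (intro finite_word_ball) (auto simp: A_def)
  ultimately have "card (word_ball G F n) \<le> card (word_ball G A n)" for n
    by (intro card_mono)
  then show ?thesis using Cd by (meson order.trans)
qed

end

subsection \<open>Packing and colouring\<close>

text \<open>Zorn's lemma: two points in the union of a chain of independent sets already lie in one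
  member of the chain. It supplies both the colour classes and the separated nets below.\<close>

lemma maximal_independent_set:
  fixes R :: "'a \<Rightarrow> 'a \<Rightarrow> bool"
  assumes "symp R"
  obtains I where "I \<subseteq> X" "pairwise (\<lambda>x y. \<not> R x y) I" "\<And>x. x \<in> X - I \<Longrightarrow> \<exists>y\<in>I. R x y"
proof -
  let ?F = "{I. I \<subseteq> X \<and> pairwise (\<lambda>x y. \<not> R x y) I}"
  have "\<exists>M\<in>?F. \<forall>Y\<in>?F. M \<subseteq> Y \<longrightarrow> Y = M"
  proof (rule subset_Zorn')
    fix \<C> assume ch: "subset.chain ?F \<C>"
    have "pairwise (\<lambda>x y. \<not> R x y) (\<Union>\<C>)"
    proof (rule pairwiseI)
      fix x y assume "x \<in> \<Union>\<C>" "y \<in> \<Union>\<C>" "x \<noteq> y"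
      then obtain S T where ST: "S \<in> \<C>" "x \<in> S" "T \<in> \<C>" "y \<in> T" by blast
      then have "S \<subseteq> T \<or> T \<subseteq> S" "S \<in> ?F" "T \<in> ?F"
        using ch by (auto simp: subset_chain_def)
      with ST \<open>x \<noteq> y\<close> show "\<not> R x y"
        by (auto simp: pairwise_def)
    qed
    then show "\<Union>\<C> \<in> ?F"
      using ch by (auto simp: subset_chain_def)
  qed
  then obtain M where "M \<in> ?F" and max: "\<forall>Y\<in>?F. M \<subseteq> Y \<longrightarrow> Y = M"
    by (rule bexE)
  then have M: "M \<subseteq> X" "pairwise (\<lambda>x y. \<not> R x y) M"
    by auto
  have "\<exists>y\<in>M. R x y" if "x \<in> X - M" for x
  proof (rule ccontr)
    assume none: "\<not> (\<exists>y\<in>M. R x y)"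
    then have "insert x M \<in> ?F"
      using M that assms by (auto simp: pairwise_insert dest: sympD)
    then have "insert x M = M" using bspec[OF max] by blast
    with \<open>x \<in> X - M\<close> show False by blast
  qed
  with M show ?thesis by (rule that)
qed

text \<open>A maximal independent set takes one colour. Every vertex left over has a neighbour in
  it, so its removal lowers the degree bound by one; this works for infinite \<open>X\<close>.
  Finiteness is assumed separately because \<open>card\<close> of an infinite set is
  \<open>0\<close>.\<close>

lemma bounded_degree_colouring:
  fixes R :: "'a \<Rightarrow> 'a \<Rightarrow> bool"
  assumes "symp R"
    and "\<And>x. x \<in> X \<Longrightarrow> finite {y \<in> X. y \<noteq> x \<and> R x y}"
    and "\<And>x. x \<in> X \<Longrightarrow> card {y \<in> X. y \<noteq> x \<and> R x y} \<le> D"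
  shows "\<exists>col :: 'a \<Rightarrow> nat. (\<forall>x. col x \<le> D) \<and>
    (\<forall>x\<in>X. \<forall>y\<in>X. x \<noteq> y \<and> col x = col y \<longrightarrow> \<not> R x y)"
  using assms(2,3)
proof (induction D arbitrary: X)
  case 0
  have "{y \<in> X. y \<noteq> x \<and> R x y} = {}" if "x \<in> X" for x
    using 0(1)[OF that] 0(2)[OF that] by (simp only: le_zero_eq card_0_eq)
  then show ?case by (intro exI[of _ "\<lambda>_. 0"]) blast
next
  case (Suc D)
  obtain I where I: "I \<subseteq> X" "pairwise (\<lambda>x y. \<not> R x y) I"
    "\<And>x. x \<in> X - I \<Longrightarrow> \<exists>y\<in>I. R x y"
    using maximal_independent_set[OF assms(1)] by blast
  have "card {y \<in> X - I. y \<noteq> x \<and> R x y} \<le> D" if x: "x \<in> X - I" for x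
  proof -
    obtain z where "z \<in> I" "R x z" using I(3)[OF x] by blast
    then have "{y \<in> X - I. y \<noteq> x \<and> R x y} \<subset> {y \<in> X. y \<noteq> x \<and> R x y}"
      using I(1) x by blast
    then have "card {y \<in> X - I. y \<noteq> x \<and> R x y} < card {y \<in> X. y \<noteq> x \<and> R x y}"
      using Suc.prems(1) x by (intro psubset_card_mono) auto
    then show ?thesis using Suc.prems(2)[of x] x by simp
  qed
  moreover have "finite {y \<in> X - I. y \<noteq> x \<and> R x y}" if "x \<in> X - I" for x
    using Suc.prems(1)[of x] that by (rule_tac finite_subset[rotated]) auto
  ultimately have "\<exists>col :: 'a \<Rightarrow> nat. (\<forall>x. col x \<le> D) \<and>
      (\<forall>x\<in>X - I. \<forall>y\<in>X - I. x \<noteq> y \<and> col x = col y \<longrightarrow> \<not> R x y)"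
    by (intro Suc.IH)
  then obtain col :: "'a \<Rightarrow> nat" where col: "\<forall>x. col x \<le> D"
    "\<forall>x\<in>X - I. \<forall>y\<in>X - I. x \<noteq> y \<and> col x = col y \<longrightarrow> \<not> R x y"
    by blast
  have ne: "col x \<noteq> Suc D" "Suc D \<noteq> col x" for x
    using spec[OF col(1), of x] by auto
  have "(\<forall>x. (if x \<in> I then Suc D else col x) \<le> Suc D)"
    using col(1) by (simp add: le_SucI)
  moreover have "\<not> R x y"
    if "x \<in> X" "y \<in> X" "x \<noteq> y" "(if x \<in> I then Suc D else col x) = (if y \<in> I then Suc D else col y)" for x y
    using that I(2) col(2) by (auto simp: pairwise_def ne split: if_splits)
  ultimately show ?case
    by (intro exI[of _ "\<lambda>x. if x \<in> I then Suc D else col x"]) blast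
qed

text \<open>If the inequality failed at all large scales, iteration would give
  \<open>p (16 ^ j * k0) \<ge> 16 ^ (Suc d * j)\<close>, exceeding the polynomial bound of degree
  \<open>d\<close> by a factor of order \<open>16 ^ j\<close>.\<close>

lemma doubling_scale:
  fixes p :: "nat \<Rightarrow> nat"
  assumes "\<And>n. 1 \<le> n \<Longrightarrow> 1 \<le> p n" "\<And>n. 1 \<le> n \<Longrightarrow> p n \<le> C * n ^ d"
  shows "\<exists>k\<ge>r. 1 \<le> k \<and> p (16 * k) \<le> 16 ^ Suc d * p k"
proof (rule ccontr)
  assume neg: "\<not> ?thesis"
  define k0 where "k0 = max r 1"
  have k0: "1 \<le> k0" "r \<le> k0" by (auto simp: k0_def)
  have step: "16 ^ Suc d * p k \<le> p (16 * k)" if "k0 \<le> k" for k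
    using neg k0 that by (meson le_trans nle_le)
  have low: "(16 ^ Suc d) ^ j \<le> p (16 ^ j * k0)" for j
  proof (induction j)
    case 0
    then show ?case using assms(1) k0 by simp
  next
    case (Suc j)
    have "(16 ^ Suc d) ^ Suc j \<le> 16 ^ Suc d * p (16 ^ j * k0)"
      using Suc by simp
    also have "\<dots> \<le> p (16 * (16 ^ j * k0))"
      by (intro step) simp
    finally show ?case by (simp add: mult.assoc)
  qed
  \<comment> \<open>With \<open>j\<close> equal to the constant \<open>C * k0 ^ d\<close>, the
    comparison collapses to \<open>16 ^ j \<le> j\<close>.\<close>
  define j where "j = C * k0 ^ d"
  have "16 ^ (d * j) * 16 ^ j \<le> p (16 ^ j * k0)"
    using low[of j] by (simp add: power_mult power_mult_distrib mult.commute)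
  also have "\<dots> \<le> C * (16 ^ j * k0) ^ d"
    using k0 by (intro assms(2)) simp
  also have "\<dots> = 16 ^ (d * j) * j"
    by (simp add: j_def power_mult_distrib power_mult[symmetric] mult.commute mult.left_commute)
  finally have "(16::nat) ^ j \<le> j" by simp
  moreover have "j < 16 ^ j" by (rule power_gt_expt) simp
  ultimately show False by simp
qed

section \<open>Coloured nets from packing bounds, and packing bounds from word growth\<close>

context group
begin

text \<open>The degree bound is a volume argument with packing numbers as volume: copies of an
  optimal packing \<open>Q\<close> of \<open>B k\<close>, placed at the neighbours of
  \<open>x\<close>, form one packing of \<open>B (16 * k)\<close>. So the number of neighbours times
  \<open>p k\<close> is at most \<open>p (16 * k)\<close>.\<close>

lemma packing_bound_imp_coloured_nets:
  fixes U :: "'a set" and C d :: nat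
  defines "B \<equiv> word_ball G U"
  assumes U: "U \<subseteq> carrier G" "\<And>u. u \<in> U \<Longrightarrow> inv u \<in> U"
    and pack: "\<And>n Q. 1 \<le> n \<Longrightarrow> Q \<subseteq> B n \<Longrightarrow> pairwise (\<lambda>x y. inv x \<otimes> y \<notin> B 2) Q \<Longrightarrow>
      finite Q \<and> card Q \<le> C * n ^ d"
  shows "\<exists>R\<ge>r. \<exists>X col. X \<subseteq> carrier G \<and> (\<forall>x. col x \<le> 16 ^ Suc d) \<and>
    (\<forall>g\<in>carrier G. \<exists>x\<in>X. inv x \<otimes> g \<in> B R) \<and>
    (\<forall>x\<in>X. \<forall>y\<in>X. x \<noteq> y \<and> col x = (col y :: nat) \<longrightarrow> inv x \<otimes> y \<notin> B (3 * R))"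
proof -
  define packs where "packs n = {card Q | Q. Q \<subseteq> B n \<and> pairwise (\<lambda>x y. inv x \<otimes> y \<notin> B 2) Q}" for n
  define p where "p n = Max (packs n)" for n
  have Bc: "B n \<subseteq> carrier G" for n
    unfolding B_def by (rule word_ball_subset_carrier[OF U(1)])
  have Bmult: "x \<otimes> y \<in> B n" if "x \<in> B i" "y \<in> B j" "i + j \<le> n" for x y i j n
    using word_ball_mult[OF U(1), of x i y j] word_ball_mono[of "i + j" n U U G] that
    unfolding B_def by blast
  have Binv: "inv x \<in> B n" if "x \<in> B n" for x n
    using word_ball_inv[OF U] that unfolding B_def by blast
  have fin: "finite (packs n)" if "1 \<le> n" for n
    by (rule finite_subset[of _ "{..C * n ^ d}"]) (use pack[OF that] in \<open>auto simp: packs_def\<close>)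
  have p_mem: "p n \<in> packs n" if "1 \<le> n" for n
    unfolding p_def
  proof (rule Max_in[OF fin[OF that]])
    have "card {} \<in> packs n"
      unfolding packs_def by (rule CollectI, rule exI[of _ "{}"]) simp
    then show "packs n \<noteq> {}" by blast
  qed
  have p_ge: "card Q \<le> p n"
    if "1 \<le> n" "Q \<subseteq> B n" "pairwise (\<lambda>x y. inv x \<otimes> y \<notin> B 2) Q" for n Q
    unfolding p_def by (rule Max_ge[OF fin[OF that(1)]]) (use that in \<open>auto simp: packs_def\<close>)
  have "1 \<le> p n" if "1 \<le> n" for n
    using p_ge[OF that, of "{\<one>}"] by (simp add: B_def)
  moreover have "p n \<le> C * n ^ d" if "1 \<le> n" for n
    using p_mem[OF that] pack[OF that] by (auto simp: packs_def)
  ultimately obtain k where k: "r \<le> k" "1 \<le> k" "p (16 * k) \<le> 16 ^ Suc d * p k" "1 \<le> p k"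
    using doubling_scale[of p C d r] by blast
  \<comment> \<open>\<open>R\<close> must be at least \<open>2 * k + 2\<close>, so that packings
    placed at distinct net points stay separated; moreover \<open>3 * R + k = 13 * k\<close> must
    not exceed \<open>16 * k\<close>.\<close>
  define R where "R = 4 * k"
  \<comment> \<open>\<open>symp\<close> ranges over the whole type, so membership in the carrier is
    made part of the relation.\<close>
  have symp_B: "symp (\<lambda>x y. x \<in> carrier G \<and> y \<in> carrier G \<and> inv x \<otimes> y \<in> B n)" for n
  proof (rule sympI)
    fix x y assume a: "x \<in> carrier G \<and> y \<in> carrier G \<and> inv x \<otimes> y \<in> B n"
    then have "inv (inv x \<otimes> y) \<in> B n" by (intro Binv) auto
    with a show "y \<in> carrier G \<and> x \<in> carrier G \<and> inv y \<otimes> x \<in> B n"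
      by (simp add: inv_mult_group)
  qed
  obtain X where X: "X \<subseteq> carrier G"
    "pairwise (\<lambda>x y. \<not> (x \<in> carrier G \<and> y \<in> carrier G \<and> inv x \<otimes> y \<in> B R)) X"
    "\<And>g. g \<in> carrier G - X \<Longrightarrow> \<exists>x\<in>X. g \<in> carrier G \<and> x \<in> carrier G \<and> inv g \<otimes> x \<in> B R"
    using maximal_independent_set[OF symp_B[of R], of "carrier G"] by blast
  have cover: "\<exists>x\<in>X. inv x \<otimes> g \<in> B R" if g: "g \<in> carrier G" for g
  proof (cases "g \<in> X")
    case True
    then show ?thesis using g by (intro bexI[of _ g]) (auto simp: B_def)
  next
    case False
    then show ?thesis using X(3)[of g] g sympD[OF symp_B[of R]] by blast
  qed
  obtain Q where Q: "Q \<subseteq> B k" "pairwise (\<lambda>x y. inv x \<otimes> y \<notin> B 2) Q" "card Q = p k"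
    using p_mem[OF k(2)] by (auto simp: packs_def)
  have degree: "finite N \<and> card N \<le> 16 ^ Suc d"
    if x: "x \<in> X" and N: "N = {y \<in> X. y \<noteq> x \<and> x \<in> carrier G \<and> y \<in> carrier G \<and> inv x \<otimes> y \<in> B (3 * R)}" for x N
  proof -
    define M where "M = (\<lambda>(y, q). inv x \<otimes> y \<otimes> q) ` (N \<times> Q)"
    have xc: "x \<in> carrier G" and Nc: "N \<subseteq> carrier G" and Qc: "Q \<subseteq> carrier G"
      using x X(1) N Q(1) Bc by auto
    \<comment> \<open>For equal centres this is the separation of \<open>Q\<close>. For distinct
      ones, closeness would put \<open>inv y \<otimes> y'\<close> into \<open>B (2 * k + 2)\<close>,
      hence into \<open>B R\<close>, against the separation of \<open>X\<close>.\<close>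
    have far: "inv (inv x \<otimes> y \<otimes> q) \<otimes> (inv x \<otimes> y' \<otimes> q') \<notin> B 2"
      if "y \<in> N" "y' \<in> N" "q \<in> Q" "q' \<in> Q" "(y, q) \<noteq> (y', q')" for y y' q q'
    proof
      have c: "y \<in> carrier G" "y' \<in> carrier G" "q \<in> carrier G" "q' \<in> carrier G"
        using that Nc Qc by auto
      have xx: "x \<otimes> (inv x \<otimes> z) = z" if "z \<in> carrier G" for z
        using that xc by (simp add: m_assoc[symmetric])
      have eq: "inv (inv x \<otimes> y \<otimes> q) \<otimes> (inv x \<otimes> y' \<otimes> q') = inv q \<otimes> (inv y \<otimes> y') \<otimes> q'"
        using c xc by (simp add: inv_mult_group m_assoc xx)
      assume "inv (inv x \<otimes> y \<otimes> q) \<otimes> (inv x \<otimes> y' \<otimes> q') \<in> B 2"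
      then have in2: "inv q \<otimes> (inv y \<otimes> y') \<otimes> q' \<in> B 2" using eq by simp
      show False
      proof (cases "y = y'")
        case True
        then show False using in2 c Q(2) that by (auto simp: pairwise_def)
      next
        case False
        have "q \<in> B k" "inv q' \<in> B k" using Q(1) that Binv by auto
        have "q \<otimes> (inv q \<otimes> (inv y \<otimes> y') \<otimes> q') \<in> B (k + 2)"
          by (rule Bmult[OF \<open>q \<in> B k\<close> in2]) simp
        then have "q \<otimes> (inv q \<otimes> (inv y \<otimes> y') \<otimes> q') \<otimes> inv q' \<in> B R"
          by (rule Bmult[OF _ \<open>inv q' \<in> B k\<close>]) (use k in \<open>simp add: R_def\<close>)
        moreover have "q \<otimes> (inv q \<otimes> (inv y \<otimes> y') \<otimes> q') \<otimes> inv q' = inv y \<otimes> y'"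
        proof -
          have qq: "q \<otimes> (inv q \<otimes> z) = z" if "z \<in> carrier G" for z
            using that c by (simp add: m_assoc[symmetric])
          show ?thesis using c by (simp add: m_assoc qq)
        qed
        ultimately show False
          using X(2) False that N by (auto simp: pairwise_def)
      qed
    qed
    \<comment> \<open>Coinciding products would differ by the identity, which lies in
      \<open>B 2\<close>; so separation already forces injectivity.\<close>
    have inj: "inj_on (\<lambda>(y, q). inv x \<otimes> y \<otimes> q) (N \<times> Q)"
    proof (rule inj_onI, clarify)
      fix y q y' q' assume a: "y \<in> N" "q \<in> Q" "y' \<in> N" "q' \<in> Q"
        "inv x \<otimes> y \<otimes> q = inv x \<otimes> y' \<otimes> q'"
      have "inv x \<otimes> y' \<otimes> q' \<in> carrier G" using a xc Nc Qc by blast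
      then have "inv (inv x \<otimes> y \<otimes> q) \<otimes> (inv x \<otimes> y' \<otimes> q') \<in> B 2"
        unfolding a(5) by (simp add: B_def)
      then show "y = y' \<and> q = q'" using far[of y y' q q'] a by blast
    qed
    have "pairwise (\<lambda>x y. inv x \<otimes> y \<notin> B 2) M"
      unfolding M_def by (rule pairwiseI) (use far in auto)
    moreover have "M \<subseteq> B (16 * k)"
    proof -
      have "inv x \<otimes> y \<otimes> q \<in> B (16 * k)" if "y \<in> N" "q \<in> Q" for y q
        by (rule Bmult[of _ "3 * R" _ k]) (use that N Q(1) in \<open>auto simp: R_def\<close>)
      then show ?thesis by (auto simp: M_def)
    qed
    ultimately have M: "finite M" "card M \<le> p (16 * k)"
      using pack[of "16 * k" M] p_ge[of "16 * k" M] k by auto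
    have "Q \<noteq> {}" "finite Q" using Q(3) k(4) by (auto intro: card_ge_0_finite)
    have "finite (N \<times> Q)"
      using M(1) inj by (simp add: M_def finite_image_iff)
    then have "finite N" using \<open>Q \<noteq> {}\<close> by (metis finite_cartesian_productD1)
    moreover have "card N * p k \<le> 16 ^ Suc d * p k"
    proof -
      have "card N * p k = card M"
        using inj Q(3) by (simp add: M_def card_image card_cartesian_product)
      then show ?thesis using M(2) k(3) by simp
    qed
    ultimately show ?thesis using k(4) by simp
  qed
  have "\<exists>col :: 'a \<Rightarrow> nat. (\<forall>x. col x \<le> 16 ^ Suc d) \<and>
    (\<forall>x\<in>X. \<forall>y\<in>X. x \<noteq> y \<and> col x = col y \<longrightarrow>
      \<not> (x \<in> carrier G \<and> y \<in> carrier G \<and> inv x \<otimes> y \<in> B (3 * R)))"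
    by (rule bounded_degree_colouring[OF symp_B]) (use degree[OF _ refl] in simp_all)
  then obtain col :: "'a \<Rightarrow> nat" where col: "\<forall>x. col x \<le> 16 ^ Suc d"
    "\<forall>x\<in>X. \<forall>y\<in>X. x \<noteq> y \<and> col x = col y \<longrightarrow>
      \<not> (x \<in> carrier G \<and> y \<in> carrier G \<and> inv x \<otimes> y \<in> B (3 * R))"
    by blast
  have "r \<le> R" using k by (simp add: R_def)
  moreover have "\<forall>x\<in>X. \<forall>y\<in>X. x \<noteq> y \<and> col x = col y \<longrightarrow> inv x \<otimes> y \<notin> B (3 * R)"
    using col(2) X(1) by blast
  moreover have "\<forall>g\<in>carrier G. \<exists>x\<in>X. inv x \<otimes> g \<in> B R"
    using cover by (rule ballI)
  ultimately show ?thesis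
    using X(1) col(1) by (intro exI[of _ R] exI[of _ X] exI[of _ col] conjI)
qed

text \<open>The inclusion of \<open>U <#> U\<close> lets a single \<open>U\<close>-letter be pushed
  rightwards through a word, each further letter being traded for one of \<open>F\<close>. Two
  points with the same \<open>F\<close>-part differ by \<open>inv u \<otimes> v\<close> with
  \<open>u\<close> and \<open>v\<close> in \<open>U\<close>, so on a separated set the
  \<open>F\<close>-part is injective.\<close>

lemma packing_le_card_word_ball:
  assumes U: "U \<subseteq> carrier G" "\<one> \<in> U" "\<And>u. u \<in> U \<Longrightarrow> inv u \<in> U"
    and F: "finite F" "F \<subseteq> carrier G" "U <#> U \<subseteq> F <#> U"
    and Q: "Q \<subseteq> word_ball G U n" "pairwise (\<lambda>x y. inv x \<otimes> y \<notin> word_ball G U 2) Q"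
  shows "finite Q \<and> card Q \<le> card (word_ball G F n)"
proof -
  have word: "list_prod G xs \<in> word_ball G F (length xs) <#> U" if "set xs \<subseteq> U" for xs
    using that
  proof (induction xs rule: rev_induct)
    case Nil
    have "\<one> \<otimes> \<one> \<in> word_ball G F 0 <#> U"
      unfolding set_mult_def using U(2) one_in_word_ball by blast
    then show ?case by simp
  next
    case (snoc x xs)
    then obtain g u where gu: "g \<in> word_ball G F (length xs)" "u \<in> U" "list_prod G xs = g \<otimes> u"
      by (auto simp: set_mult_def)
    have "u \<otimes> x \<in> U <#> U" using gu snoc.prems by (auto simp: set_mult_def)
    then have "u \<otimes> x \<in> F <#> U" using F(3) by blast
    then obtain f v where fv: "f \<in> F" "v \<in> U" "u \<otimes> x = f \<otimes> v"
      by (auto simp: set_mult_def)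
    have c: "g \<in> carrier G" "u \<in> carrier G" "x \<in> carrier G" "f \<in> carrier G" "v \<in> carrier G"
      "set xs \<subseteq> carrier G"
      using gu fv snoc.prems U(1) F(2) word_ball_subset_carrier[OF F(2)] by auto
    have "list_prod G (xs @ [x]) = g \<otimes> (u \<otimes> x)"
      using c gu(3) by (simp add: list_prod_append m_assoc)
    also have "\<dots> = g \<otimes> f \<otimes> v" using c fv(3) by (simp add: m_assoc)
    finally have "list_prod G (xs @ [x]) = g \<otimes> f \<otimes> v" .
    moreover have "g \<otimes> f \<in> word_ball G F (length (xs @ [x]))"
      using word_ball_mult[OF F(2) gu(1), of f 1] subset_word_ball[OF F(2), of 1] fv(1) by auto
    ultimately show ?case using fv(2) unfolding set_mult_def by blast
  qed
  have "\<exists>g\<in>word_ball G F n. \<exists>u\<in>U. q = g \<otimes> u" if "q \<in> Q" for q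
  proof -
    have "q \<in> word_ball G U n" using that Q(1) by blast
    then obtain xs where xs: "set xs \<subseteq> U" "length xs \<le> n" "q = list_prod G xs"
      by (rule word_ball_memE)
    then have "q \<in> word_ball G F (length xs) <#> U" using word by simp
    then show ?thesis
      using word_ball_mono[of "length xs" n F F G] xs(2) by (fastforce simp: set_mult_def)
  qed
  then obtain h where h: "\<And>q. q \<in> Q \<Longrightarrow> h q \<in> word_ball G F n \<and> (\<exists>u\<in>U. q = h q \<otimes> u)"
    by metis
  have "inj_on h Q"
  proof (rule inj_onI, rule ccontr)
    fix p q assume pq: "p \<in> Q" "q \<in> Q" "h p = h q" "p \<noteq> q"
    obtain u where u: "u \<in> U" "p = h p \<otimes> u" using h[OF pq(1)] by blast
    obtain v where v: "v \<in> U" "q = h p \<otimes> v" using h[OF pq(2)] pq(3) by auto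
    have c: "h p \<in> carrier G" "u \<in> carrier G" "v \<in> carrier G"
      using h[OF pq(1)] word_ball_subset_carrier[OF F(2)] u v U(1) by auto
    have "inv p \<otimes> q = inv (h p \<otimes> u) \<otimes> (h p \<otimes> v)" using u(2) v(2) by simp
    also have "\<dots> = inv u \<otimes> (inv (h p) \<otimes> (h p \<otimes> v))"
      using c by (simp add: inv_mult_group m_assoc)
    also have "\<dots> = inv u \<otimes> v" using c by (simp add: m_assoc[symmetric])
    finally have "inv p \<otimes> q = inv u \<otimes> v" .
    moreover have "inv u \<otimes> v \<in> word_ball G U (1 + 1)"
      using u v U subset_word_ball[OF U(1), of 1] by (intro word_ball_mult[OF U(1)]) auto
    ultimately have "inv p \<otimes> q \<in> word_ball G U 2" unfolding one_add_one by simp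
    then show False using Q(2) pq by (auto simp: pairwise_def)
  qed
  moreover have "h ` Q \<subseteq> word_ball G F n" using h by blast
  ultimately show ?thesis
    using finite_word_ball[OF F(1), of G n]
    by (meson card_inj_on_le inj_on_finite)
qed

end
subsection \<open>Topological groups\<close>

context topological_group
begin

lemma compactin_subset_carrier: "compactin T A \<Longrightarrow> A \<subseteq> carrier G"
  using compactin_subset_topspace topspace_eq_carrier by metis

lemma set_mult_eq_image: "A <#> B = (\<lambda>(x, y). x \<otimes> y) ` (A \<times> B)"
  by (auto simp: set_mult_def)

lemma compactin_set_mult: "compactin T A \<Longrightarrow> compactin T B \<Longrightarrow> compactin T (A <#> B)"
  unfolding set_mult_eq_image
  by (rule image_compactin[OF _ continuous_mult]) (simp add: compactin_Times)

lemma compactin_inv_image: "compactin T A \<Longrightarrow> compactin T ((\<lambda>x. inv x) ` A)"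
  by (rule image_compactin[OF _ continuous_inv])

lemma continuous_left_mult: "g \<in> carrier G \<Longrightarrow> continuous_map T T (\<lambda>x. g \<otimes> x)"
  using continuous_map_compose[OF continuous_map_pairedI[of T T "\<lambda>_. g" T "\<lambda>x. x"] continuous_mult]
  by (simp add: topspace_eq_carrier o_def)

lemma openin_l_coset:
  assumes "openin T W" "g \<in> carrier G"
  shows "openin T (g <# W)"
proof -
  have W: "W \<subseteq> carrier G" using openin_subset[OF assms(1)] topspace_eq_carrier by simp
  have "g <# W = {x \<in> topspace T. inv g \<otimes> x \<in> W}"
  proof (intro equalityI subsetI)
    fix x assume "x \<in> g <# W"
    then obtain w where "w \<in> W" "x = g \<otimes> w" by (auto simp: l_coset_def)
    then show "x \<in> {x \<in> topspace T. inv g \<otimes> x \<in> W}"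
      using W assms(2) by (auto simp: topspace_eq_carrier m_assoc[symmetric])
  next
    fix x assume x: "x \<in> {x \<in> topspace T. inv g \<otimes> x \<in> W}"
    then have "x = g \<otimes> (inv g \<otimes> x)"
      using assms(2) by (simp add: topspace_eq_carrier m_assoc[symmetric])
    with x show "x \<in> g <# W" unfolding l_coset_def by blast
  qed
  then show ?thesis
    using openin_continuous_map_preimage[OF continuous_left_mult assms(1), of "inv g"] assms(2) by simp
qed

lemma openin_set_mult:
  assumes "A \<subseteq> carrier G" "openin T W"
  shows "openin T (A <#> W)"
proof -
  have "A <#> W = (\<Union>a\<in>A. a <# W)" by (auto simp: set_mult_def l_coset_def)
  moreover have "openin T (\<Union>a\<in>A. a <# W)"
    using assms openin_l_coset by (intro openin_Union) auto
  ultimately show ?thesis by simp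
qed

text \<open>The translates of \<open>W\<close> by \<open>A\<close> form an open cover. What matters
  later is that the finitely many centres come from \<open>A\<close>, which will be the nilpotent
  subgroup.\<close>

lemma compactin_finite_translates:
  assumes "compactin T D" "openin T W" "A \<subseteq> carrier G" "D \<subseteq> A <#> W"
  obtains F where "finite F" "F \<subseteq> A" "D \<subseteq> F <#> W"
proof -
  have "D \<subseteq> \<Union>((\<lambda>a. a <# W) ` A)"
    using assms(4) by (auto simp: set_mult_def l_coset_def)
  moreover have "\<forall>V\<in>(\<lambda>a. a <# W) ` A. openin T V"
    using assms openin_l_coset by auto
  ultimately obtain \<F> where \<F>: "finite \<F>" "\<F> \<subseteq> (\<lambda>a. a <# W) ` A" "D \<subseteq> \<Union>\<F>"
    using assms(1) unfolding compactin_def by meson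
  obtain F where F: "F \<subseteq> A" "finite F" "\<F> = (\<lambda>a. a <# W) ` F"
    using finite_subset_image[OF \<F>(1,2)] by blast
  then have "D \<subseteq> F <#> W"
    using \<F>(3) by (auto simp: set_mult_def l_coset_def)
  with F show ?thesis by (intro that)
qed

lemma compactin_word_ball:
  assumes "compactin T U" "\<one> \<in> U"
  shows "compactin T (word_ball G U n)"
proof (induction n)
  case 0
  have "word_ball G U 0 = {\<one>}" by (auto simp: word_ball_def)
  then show ?case by (simp add: topspace_eq_carrier)
next
  case (Suc n)
  note U = compactin_subset_carrier[OF assms(1)]
  have "word_ball G U (Suc n) = U <#> word_ball G U n"
  proof (intro equalityI subsetI)
    fix x assume "x \<in> word_ball G U (Suc n)"
    then obtain xs where xs: "set xs \<subseteq> U" "length xs \<le> Suc n" "x = list_prod G xs"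
      by (rule word_ball_memE)
    show "x \<in> U <#> word_ball G U n"
    proof (cases xs)
      case Nil
      then have "x = \<one> \<otimes> \<one>" using xs by simp
      moreover have "\<one> \<in> word_ball G U n" by simp
      ultimately show ?thesis unfolding set_mult_def using assms(2) by blast
    next
      case (Cons y ys)
      then have "x = y \<otimes> list_prod G ys" "y \<in> U" "list_prod G ys \<in> word_ball G U n"
        using xs by (auto intro: word_ball_memI)
      then show ?thesis unfolding set_mult_def by blast
    qed
  next
    fix x assume "x \<in> U <#> word_ball G U n"
    then obtain u y where "u \<in> U" "y \<in> word_ball G U n" "x = u \<otimes> y"
      by (auto simp: set_mult_def)
    then show "x \<in> word_ball G U (Suc n)"
      using word_ball_mult[OF U, of u 1 y n] subset_word_ball[OF U, of 1] by auto
  qed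
  then show ?case using Suc assms(1) compactin_set_mult by simp
qed

text \<open>The balls need not be open, so \<open>D\<close> is covered by finitely many translates
  of \<open>W\<close>. Their centres lie in a common ball, and \<open>W\<close> costs one more
  letter.\<close>

lemma compactin_subset_some_word_ball:
  assumes "compactin T D" "openin T W" "\<one> \<in> W" "W \<subseteq> U" "U \<subseteq> carrier G"
    and gen: "carrier G \<subseteq> (\<Union>n. word_ball G U n)"
  obtains n where "D \<subseteq> word_ball G U n"
proof -
  have "D \<subseteq> carrier G <#> W"
  proof
    fix x assume "x \<in> D"
    then have x: "x \<in> carrier G" using compactin_subset_carrier[OF assms(1)] by blast
    then have "x \<otimes> \<one> \<in> carrier G <#> W"
      using assms(3) unfolding set_mult_def by blast
    with x show "x \<in> carrier G <#> W" by simp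
  qed
  then obtain F where F: "finite F" "F \<subseteq> carrier G" "D \<subseteq> F <#> W"
    by (rule compactin_finite_translates[OF assms(1,2) subset_refl])
  have "\<forall>f\<in>F. \<exists>n. f \<in> word_ball G U n" using F(2) gen by blast
  then obtain m where m: "\<forall>f\<in>F. f \<in> word_ball G U (m f)" by metis
  obtain k where k: "\<forall>i\<in>m ` F. i \<le> k"
    using finite_imageI[OF F(1), of m] unfolding finite_nat_set_iff_bounded_le by blast
  have "f \<otimes> w \<in> word_ball G U (k + 1)" if "f \<in> F" "w \<in> W" for f w
  proof (rule word_ball_mult[OF assms(5)])
    show "f \<in> word_ball G U k"
      using that(1) m k word_ball_mono[of "m f" k U U G] by blast
    show "w \<in> word_ball G U 1"
      using that(2) assms(4) subset_word_ball[OF assms(5), of 1] by blast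
  qed
  then have "D \<subseteq> word_ball G U (k + 1)"
    using F(3) by (auto simp: set_mult_def)
  then show ?thesis by (rule that)
qed

section \<open>Controlled sets of the left coarse structure\<close>

lemma controlledI:
  assumes "Hausdorff_space T" "compactin T D" "E \<subseteq> carrier G \<times> carrier G"
    and "\<And>x y. (x, y) \<in> E \<Longrightarrow> inv x \<otimes> y \<in> D"
  shows "E \<in> left_coarse_structure G T"
proof -
  have "(\<lambda>(x, y). inv x \<otimes> y) ` E \<subseteq> D" using assms(4) by auto
  \<comment> \<open>Hausdorffness enters here: it makes the compact set \<open>D\<close> closed, so
    \<open>D\<close> contains the closure.\<close>
  then have "T closure_of ((\<lambda>(x, y). inv x \<otimes> y) ` E) \<subseteq> D"
    by (rule closure_of_minimal) (rule compactin_imp_closedin[OF assms(1,2)])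
  then have "compactin T (T closure_of ((\<lambda>(x, y). inv x \<otimes> y) ` E))"
    by (rule closed_compactin[OF assms(2)]) simp
  then show ?thesis using assms(3) by (simp add: left_coarse_structure_def)
qed

lemma controlledE:
  assumes "E \<in> left_coarse_structure G T"
  obtains D where "compactin T D" "\<forall>(x, y)\<in>E. inv x \<otimes> y \<in> D"
proof
  show "compactin T (T closure_of ((\<lambda>(x, y). inv x \<otimes> y) ` E))"
    using assms by (simp add: left_coarse_structure_def)
  have "(\<lambda>(x, y). inv x \<otimes> y) ` E \<subseteq> topspace T"
    using assms by (auto simp: left_coarse_structure_def topspace_eq_carrier)
  from closure_of_subset[OF this]
  show "\<forall>(x, y)\<in>E. inv x \<otimes> y \<in> T closure_of ((\<lambda>(x, y). inv x \<otimes> y) ` E)"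
    by (auto simp: image_subset_iff)
qed

text \<open>\<open>P\<close> need not be closed, so its finite set \<open>F\<close> is obtained by
  compactness: the open set \<open>K' <#> W\<close> has \<open>P\<close>-translates covering
  \<open>G\<close>, and finitely many of them cover \<open>U <#> U\<close>. As
  \<open>K' <#> W\<close> lies in \<open>U\<close>, the required inclusion follows.\<close>

lemma virtually_nilpotent_generating_set:
  assumes "locally_compact_space T" "compactly_generated_group G T"
    and "topologically_virtually_nilpotent G T"
  obtains U W F C d where "compactin T U" "openin T W" "\<one> \<in> W" "W \<subseteq> U"
    "\<forall>u\<in>U. inv u \<in> U" "carrier G \<subseteq> (\<Union>n. word_ball G U n)"
    "finite F" "F \<subseteq> carrier G" "U <#> U \<subseteq> F <#> U"
    "\<forall>n\<ge>1. card (word_ball G F n) \<le> C * n ^ d"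
proof -
  obtain S where S: "compactin T S" "generate G S = carrier G"
    using assms(2) by (auto simp: compactly_generated_group_def)
  obtain P K where P: "subgroup P G" "nilpotent_group (G\<lparr>carrier := P\<rparr>)"
    and K: "compactin T K" "carrier G = K <#> P"
    using assms(3) by (auto simp: topologically_virtually_nilpotent_def cocompact_subgroup_def)
  obtain W L where W: "openin T W" "\<one> \<in> W" "W \<subseteq> L" and L: "compactin T L"
    using assms(1) one_closed unfolding locally_compact_space_def topspace_eq_carrier by metis
  note sub = compactin_subset_carrier
  have Pc: "P \<subseteq> carrier G" by (rule subgroup.subset[OF P(1)])
  define K' where "K' = (\<lambda>x. inv x) ` K"
  have K': "compactin T K'" unfolding K'_def by (rule compactin_inv_image[OF K(1)])
  \<comment> \<open>\<open>S\<close> makes the set generating, \<open>L\<close> makes it a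
    neighbourhood of the identity, and \<open>K' <#> L\<close> makes room for the translated
    pieces.\<close>
  define U1 where "U1 = S \<union> L \<union> (K' <#> L)"
  define U where "U = U1 \<union> (\<lambda>x. inv x) ` U1"
  have U1: "compactin T U1"
    unfolding U1_def by (intro compactin_Un S(1) L compactin_set_mult K')
  have Uco: "compactin T U"
    unfolding U_def by (intro compactin_Un U1 compactin_inv_image)
  have Uinv: "inv u \<in> U" if "u \<in> U" for u
    using that sub[OF U1] by (auto simp: U_def)
  have WU: "W \<subseteq> U" using W(3) by (auto simp: U_def U1_def)
  have VU: "K' <#> W \<subseteq> U"
    using W(3) mono_set_mult[of K' K' W L G] by (auto simp: U_def U1_def)
  have "generate G S \<subseteq> generate G U" by (rule mono_generate) (auto simp: U_def U1_def)
  then have gen: "carrier G \<subseteq> (\<Union>n. word_ball G U n)"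
    using generate_subset_word_balls[OF sub[OF Uco] Uinv] S(2) by blast
  \<comment> \<open>Inverting \<open>G = K P\<close> moves \<open>P\<close> to the left, the side on
    which the letters of \<open>F\<close> must appear.\<close>
  have "carrier G \<subseteq> P <#> (K' <#> W)"
  proof
    fix g assume g: "g \<in> carrier G"
    then have "inv g \<in> K <#> P" using K(2) inv_closed by blast
    then obtain k p where kp: "k \<in> K" "p \<in> P" "inv g = k \<otimes> p" by (auto simp: set_mult_def)
    have c: "k \<in> carrier G" "p \<in> carrier G" using kp sub[OF K(1)] Pc by auto
    have "g = inv (k \<otimes> p)" using g kp(3)[symmetric] by simp
    also have "\<dots> = inv p \<otimes> (inv k \<otimes> \<one>)" using c by (simp add: inv_mult_group)
    finally have "g = inv p \<otimes> (inv k \<otimes> \<one>)" .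
    moreover have "inv p \<in> P" using subgroup.m_inv_closed[OF P(1) kp(2)] .
    moreover have "inv k \<otimes> \<one> \<in> K' <#> W"
      using kp(1) W(2) unfolding set_mult_def K'_def by blast
    ultimately show "g \<in> P <#> (K' <#> W)" unfolding set_mult_def by blast
  qed
  moreover have UU: "compactin T (U <#> U)" by (rule compactin_set_mult[OF Uco Uco])
  ultimately have "U <#> U \<subseteq> P <#> (K' <#> W)" using sub[OF UU] by blast
  then obtain F where F: "finite F" "F \<subseteq> P" "U <#> U \<subseteq> F <#> (K' <#> W)"
    by (rule compactin_finite_translates[OF UU openin_set_mult[OF sub[OF K'] W(1)] Pc])
  have FU: "U <#> U \<subseteq> F <#> U"
    using F(3) mono_set_mult[OF subset_refl VU] by blast
  interpret H: group "G\<lparr>carrier := P\<rparr>" by (rule subgroup.subgroup_is_group[OF P(1) is_group])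
  obtain C d where growth: "\<forall>n\<ge>1. card (word_ball G F n) \<le> C * n ^ d"
    using H.nilpotent_polynomial_growth[OF P(2) F(1)] F(2) by auto
  have "\<forall>u\<in>U. inv u \<in> U" "F \<subseteq> carrier G" using Uinv F(2) Pc by auto
  then show ?thesis
    by (rule that[OF Uco W(1,2) WU _ gen F(1) _ FU growth])
qed

text \<open>The cover consists of balls of radius \<open>R\<close> around a coloured net, with
  \<open>R\<close> large enough to absorb \<open>E\<close>. The number of colours depends on
  \<open>d\<close> alone, so one bound serves every controlled set.\<close>

lemma asdim_le_of_packing_bound:
  fixes C d :: nat
  assumes "Hausdorff_space T" "compactin T U" "openin T W" "\<one> \<in> W" "W \<subseteq> U"
    and Uinv: "\<And>u. u \<in> U \<Longrightarrow> inv u \<in> U" and gen: "carrier G \<subseteq> (\<Union>n. word_ball G U n)"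
    and pack: "\<And>n Q. 1 \<le> n \<Longrightarrow> Q \<subseteq> word_ball G U n \<Longrightarrow>
      pairwise (\<lambda>x y. inv x \<otimes> y \<notin> word_ball G U 2) Q \<Longrightarrow> finite Q \<and> card Q \<le> C * n ^ d"
  shows "asdim_le (carrier G) (left_coarse_structure G T) (16 ^ Suc d)"
  unfolding asdim_le_def
proof
  fix E assume "E \<in> left_coarse_structure G T"
  then obtain D where D: "compactin T D" "\<forall>(x, y)\<in>E. inv x \<otimes> y \<in> D"
    by (rule controlledE)
  let ?B = "word_ball G U"
  note U = compactin_subset_carrier[OF assms(2)]
  obtain r where r: "D \<subseteq> ?B r"
    by (rule compactin_subset_some_word_ball[OF D(1) assms(3-5) U gen])
  have "\<exists>R\<ge>r. \<exists>X col. X \<subseteq> carrier G \<and> (\<forall>x. col x \<le> 16 ^ Suc d) \<and>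
      (\<forall>g\<in>carrier G. \<exists>x\<in>X. inv x \<otimes> g \<in> ?B R) \<and>
      (\<forall>x\<in>X. \<forall>y\<in>X. x \<noteq> y \<and> col x = (col y :: nat) \<longrightarrow> inv x \<otimes> y \<notin> ?B (3 * R))"
    by (rule packing_bound_imp_coloured_nets[OF U Uinv pack])
  then obtain R X col where R: "r \<le> R" and X: "X \<subseteq> carrier G"
    and col: "\<forall>x. col x \<le> 16 ^ Suc d"
    and cover: "\<forall>g\<in>carrier G. \<exists>x\<in>X. inv x \<otimes> g \<in> ?B R"
    and far: "\<forall>x\<in>X. \<forall>y\<in>X. x \<noteq> y \<and> col x = (col y :: nat) \<longrightarrow> inv x \<otimes> y \<notin> ?B (3 * R)"
    by (elim exE conjE) (rule that; assumption)
  note Bc = word_ball_subset_carrier[OF U, of R]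
  define \<U> where "\<U> i = (\<lambda>x. x <# ?B R) ` {x \<in> X. col x = i}" for i
  have cancel: "inv (x \<otimes> b) \<otimes> (x \<otimes> c) = inv b \<otimes> c"
    if "x \<in> carrier G" "b \<in> carrier G" "c \<in> carrier G" for x b c
  proof -
    have "inv (x \<otimes> b) \<otimes> (x \<otimes> c) = inv b \<otimes> (inv x \<otimes> (x \<otimes> c))"
      using that by (simp add: inv_mult_group m_assoc)
    then show ?thesis using that by (simp add: m_assoc[symmetric])
  qed
  have "(\<Union>i\<le>16 ^ Suc d. \<Union>(\<U> i)) = carrier G"
  proof (intro equalityI subsetI)
    fix g assume "g \<in> (\<Union>i\<le>16 ^ Suc d. \<Union>(\<U> i))"
    then obtain x b where "x \<in> X" "b \<in> ?B R" "g = x \<otimes> b"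
      by (auto simp: \<U>_def l_coset_def)
    then show "g \<in> carrier G" using X Bc by auto
  next
    fix g assume g: "g \<in> carrier G"
    then obtain x where x: "x \<in> X" "inv x \<otimes> g \<in> ?B R" using cover by blast
    then have "g = x \<otimes> (inv x \<otimes> g)" using g X by (auto simp: m_assoc[symmetric])
    then have "g \<in> x <# ?B R" using x(2) unfolding l_coset_def by blast
    moreover have "x <# ?B R \<in> \<U> (col x)" using x(1) by (auto simp: \<U>_def)
    ultimately show "g \<in> (\<Union>i\<le>16 ^ Suc d. \<Union>(\<U> i))" using col by blast
  qed
  moreover have "(A \<times> A') \<inter> E = {}" if AA: "A \<in> \<U> i" "A' \<in> \<U> i" "A \<noteq> A'" for i A A'
  proof (rule ccontr)
    assume "(A \<times> A') \<inter> E \<noteq> {}"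
    then obtain a a' where a: "a \<in> A" "a' \<in> A'" "(a, a') \<in> E" by blast
    obtain x x' where x: "x \<in> X" "A = x <# ?B R" "x' \<in> X" "A' = x' <# ?B R" "col x = col x'"
      using AA(1,2) by (auto simp: \<U>_def)
    obtain b where b: "b \<in> ?B R" "a = x \<otimes> b" using a(1) x(2) by (auto simp: l_coset_def)
    obtain b' where b': "b' \<in> ?B R" "a' = x' \<otimes> b'" using a(2) x(4) by (auto simp: l_coset_def)
    have c: "x \<in> carrier G" "x' \<in> carrier G" "b \<in> carrier G" "b' \<in> carrier G"
      using x b b' X Bc by auto
    have "inv a \<otimes> a' \<in> ?B R"
      using D(2) a(3) r word_ball_mono[OF R, of U U G] by blast
    \<comment> \<open>The path between the two centres has three legs, out of one ball, across
      \<open>E\<close> and into the other, each of length at most \<open>R\<close>; hence the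
      separation \<open>3 * R\<close>.\<close>
    then have "b \<otimes> (inv a \<otimes> a') \<otimes> inv b' \<in> ?B (R + R + R)"
      by (intro word_ball_mult[OF U] word_ball_inv[OF U Uinv] b b')
    moreover have "b \<otimes> (inv a \<otimes> a') \<otimes> inv b' = inv x \<otimes> x'"
    proof -
      have bb: "b \<otimes> (inv b \<otimes> z) = z" if "z \<in> carrier G" for z
        using that c by (simp add: m_assoc[symmetric])
      show ?thesis using c by (simp add: b(2) b'(2) inv_mult_group m_assoc bb)
    qed
    moreover have "R + R + R = 3 * R" by simp
    ultimately have "inv x \<otimes> x' \<in> ?B (3 * R)" by metis
    moreover have "x \<noteq> x'" using AA(3) x by blast
    ultimately show False using far x by blast
  qed
  moreover have "(\<Union>i\<le>16 ^ Suc d. \<Union>A\<in>\<U> i. A \<times> A) \<in> left_coarse_structure G T"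
  proof (rule controlledI[OF assms(1)])
    \<comment> \<open>Two points of one translate differ by an element of this ball, independently
      of the centre, so the cover is uniformly bounded.\<close>
    show "compactin T (?B (R + R))"
      using assms(2,4,5) by (intro compactin_word_ball) auto
    fix y z assume "(y, z) \<in> (\<Union>i\<le>16 ^ Suc d. \<Union>A\<in>\<U> i. A \<times> A)"
    then obtain x b c where x: "x \<in> X" "b \<in> ?B R" "c \<in> ?B R" "y = x \<otimes> b" "z = x \<otimes> c"
      by (auto simp: \<U>_def l_coset_def)
    then have "inv y \<otimes> z = inv b \<otimes> c" using cancel[of x b c] X Bc by auto
    then show "inv y \<otimes> z \<in> ?B (R + R)"
      using word_ball_mult[OF U word_ball_inv[OF U Uinv x(2)] x(3)] by simp
  next
    show "(\<Union>i\<le>16 ^ Suc d. \<Union>A\<in>\<U> i. A \<times> A) \<subseteq> carrier G \<times> carrier G"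
      using calculation(1) by blast
  qed
  ultimately show "\<exists>\<U> :: nat \<Rightarrow> 'a set set. (\<Union>i\<le>16 ^ Suc d. \<Union>(\<U> i)) = carrier G \<and>
      (\<forall>i\<le>16 ^ Suc d. \<forall>A\<in>\<U> i. \<forall>B\<in>\<U> i. A \<noteq> B \<longrightarrow> A \<times> B \<inter> E = {}) \<and>
      (\<Union>i\<le>16 ^ Suc d. \<Union>A\<in>\<U> i. A \<times> A) \<in> left_coarse_structure G T"
    by (intro exI[of _ \<U>] conjI allI impI ballI)
qed

end

theorem theorem23:
  fixes G :: "('a, 'b) monoid_scheme" and T :: "'a topology"
  assumes "topological_group G T"
    and "Hausdorff_space T"
    and "locally_compact_space T"
    and "compactly_generated_group G T"
    and "topologically_virtually_nilpotent G T"
  shows "asdim G T < \<infinity>"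
proof -
  interpret topological_group G T by fact
  obtain U W F C d where U: "compactin T U" "openin T W" "\<one>\<^bsub>G\<^esub> \<in> W" "W \<subseteq> U"
    "\<forall>u\<in>U. inv\<^bsub>G\<^esub> u \<in> U" "carrier G \<subseteq> (\<Union>n. word_ball G U n)"
    and F: "finite F" "F \<subseteq> carrier G" "U <#>\<^bsub>G\<^esub> U \<subseteq> F <#>\<^bsub>G\<^esub> U"
    and growth: "\<forall>n\<ge>1. card (word_ball G F n) \<le> C * n ^ d"
    by (rule virtually_nilpotent_generating_set[OF assms(3-5)])
  have "asdim_le (carrier G) (left_coarse_structure G T) (16 ^ Suc d)"
  proof (rule asdim_le_of_packing_bound[OF assms(2) U(1-4) bspec[OF U(5)] U(6)])
    fix n Q assume n: "1 \<le> n" and Q: "Q \<subseteq> word_ball G U n"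
      "pairwise (\<lambda>x y. inv\<^bsub>G\<^esub> x \<otimes>\<^bsub>G\<^esub> y \<notin> word_ball G U 2) Q"
    have "\<one>\<^bsub>G\<^esub> \<in> U" using U(3,4) by blast
    from packing_le_card_word_ball[OF compactin_subset_carrier[OF U(1)] this bspec[OF U(5)] F Q]
    show "finite Q \<and> card Q \<le> C * n ^ d" using growth n by (meson order.trans)
  qed
  \<comment> \<open>The set of admissible dimensions now has a finite element, which bounds its
    infimum.\<close>
  then have "asdim G T \<le> enat (16 ^ Suc d)"
    unfolding asdim_def coarse_asdim_def by (intro Inf_lower) blast
  also have "\<dots> < \<infinity>" by simp
  finally show ?thesis .
qed

end
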